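(* Let $\tilde F:=F|_{Q^3}:Q^3\to\mathbb{C}^3$ be the restriction of the holomorphic extension $F$ of the Ahern-Rudin map to the affine quadric $Q^3$, and define $$t_0:=\sup\{t: \tilde F|_{M_s^3}\text{ is an embedding for all }1<s\le t\}.$$ Then $t_0\ge 1+10^{-6}$.
   Context: $Q^3:=\{(z_1,z_2,z_3,z_4)\in\mathbb{C}^4: z_1^2+z_2^2+z_3^2+z_4^2=1\}$, and for $t>1$, $M_t^3:=\{(z_1,\dots,z_4)\in\mathbb{C}^4: |z_1|^2+|z_2|^2+|z_3|^2+|z_4|^2=t\}\cap Q^3$ (a compact real hypersurface in $Q^3$). The map $F:\mathbb{C}^4\to\mathbb{C}^3$ is $$F(z_1,z_2,z_3,z_4):=\bigl(z_1+iz_2,\ z_3+iz_4,\ (z_3+iz_4)(z_1-iz_2)(z_3-iz_4)^2+i(z_1+iz_2)(z_1-iz_2)^2(z_3-iz_4)\bigr).$$ It is the holomorphic extension to $\mathbb{C}^4$ of the map $f(z,w)=(z,w,w\bar z\bar w^2+iz\bar z^2\bar w)$ on $\mathbb{C}^2$, where $\mathbb{C}^2$ is identified with $\mathbb{R}^4\subset\mathbb{C}^4$ via $(z,w)\mapsto(\operatorname{Re}z,\operatorname{Im}z,\operatorname{Re}w,\operatorname{Im}w)$. Equivalently, in the linear coordinates $w_1=z_1+iz_2$, $w_2=z_1-iz_2$, $w_3=z_3+iz_4$, $w_4=z_3-iz_4$ one has $Q^3=\{w_1w_2+w_3w_4=1\}$, $M_t^3=\{|w_1|^2+|w_2|^2+|w_3|^2+|w_4|^2=2t\}\cap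 Q^3$ and $F(w_1,w_2,w_3,w_4)=(w_1,\,w_3,\,w_2w_3w_4^2+iw_1w_2^2w_4)$. *)

theory Defs
  imports "HOL-Analysis.Analysis"
begin

(* Real C^k maps on an open set U, by iterated directional derivatives. *)
primrec Ck_on_open ::
  "nat \<Rightarrow> 'a set \<Rightarrow> ('a::euclidean_space \<Rightarrow> 'b::euclidean_space) \<Rightarrow> bool" where
  "Ck_on_open 0 U f = continuous_on U f"
| "Ck_on_open (Suc k) U f =
     (f differentiable_on U \<and> (\<forall>v. Ck_on_open k U (\<lambda>x. frechet_derivative f (at x) v)))"

definition Cinf_on_open ::
  "'a set \<Rightarrow> ('a::euclidean_space \<Rightarrow> 'b::euclidean_space) \<Rightarrow> bool" where
  "Cinf_on_open U f \<longleftrightarrow> open U \<and> (\<forall>k. Ck_on_open k U f)"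

(* Smoothness of a map on an arbitrary subset M: local smooth extendability. *)
definition smooth_on_set ::
  "'a set \<Rightarrow> ('a::euclidean_space \<Rightarrow> 'b::euclidean_space) \<Rightarrow> bool" where
  "smooth_on_set M f \<longleftrightarrow>
     (\<forall>p\<in>M. \<exists>U g. p \<in> U \<and> Cinf_on_open U g \<and> (\<forall>x\<in>U \<inter> M. g x = f x))"

(* For an embedded submanifold M this is the usual (real) tangent space T_p M,
   as velocities of smooth curves lying in M. *)
definition tangent_vectors :: "'a::euclidean_space set \<Rightarrow> 'a \<Rightarrow> 'a set" where
  "tangent_vectors M p =
     {v. \<exists>(\<gamma>::real \<Rightarrow> 'a) \<epsilon>. \<epsilon> > 0 \<and> Cinf_on_open {-\<epsilon><..<\<epsilon>} \<gamma> \<and>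
           \<gamma> ` {-\<epsilon><..<\<epsilon>} \<subseteq> M \<and> \<gamma> 0 = p \<and> (\<gamma> has_vector_derivative v) (at 0)}"

(* The derivative of f within M is not unique as a map of the ambient space, but its
   restriction to the tangent vectors of M is (it sends the velocity of a curve to the
   velocity of its image); so the choice of D below is immaterial, and only the
   values of f on M matter. *)
definition immersion_on ::
  "'a set \<Rightarrow> ('a::euclidean_space \<Rightarrow> 'b::euclidean_space) \<Rightarrow> bool" where
  "immersion_on M f \<longleftrightarrow>
     smooth_on_set M f \<and>
     (\<forall>p\<in>M. \<exists>D. (f has_derivative D) (at p within M) \<and> inj_on D (tangent_vectors M p))"

definition smooth_embedding_on ::
  "'a set \<Rightarrow> ('a::euclidean_space \<Rightarrow> 'b::euclidean_space) \<Rightarrow> bool" where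
  "smooth_embedding_on M f \<longleftrightarrow>
     immersion_on M f \<and> (\<exists>g. homeomorphism M (f ` M) f g)"

definition Q3 :: "(complex^4) set" where
  "Q3 = {z. (z$1)\<^sup>2 + (z$2)\<^sup>2 + (z$3)\<^sup>2 + (z$4)\<^sup>2 = 1}"

definition M3 :: "real \<Rightarrow> (complex^4) set" where
  "M3 t = {z. (cmod (z$1))\<^sup>2 + (cmod (z$2))\<^sup>2 + (cmod (z$3))\<^sup>2 + (cmod (z$4))\<^sup>2 = t} \<inter> Q3"

definition F :: "complex^4 \<Rightarrow> complex^3" where
  "F z = vector
     [z$1 + \<i> * z$2,
      z$3 + \<i> * z$4,
      (z$3 + \<i> * z$4) * (z$1 - \<i> * z$2) * (z$3 - \<i> * z$4)\<^sup>2
        + \<i> * (z$1 + \<i> * z$2) * (z$1 - \<i> * z$2)\<^sup>2 * (z$3 - \<i> * z$4)]"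

definition F_tilde :: "complex^4 \<Rightarrow> complex^3" where
  "F_tilde = restrict F Q3"

(* The supremum is taken in the extended reals, so that it makes sense without knowing
   that the set is bounded above. *)
definition t0 :: ereal where
  "t0 = Sup (ereal ` {t. \<forall>s. 1 < s \<and> s \<le> t \<longrightarrow> smooth_embedding_on (M3 s) F_tilde})"

end

theory Submission
  imports Defs
begin

text \<open>
  In the isotropic coordinates \<open>a = z\<^sub>1 + i z\<^sub>2\<close>, \<open>b = z\<^sub>3 + i z\<^sub>4\<close>, \<open>x = z\<^sub>1 - i z\<^sub>2\<close>,
  \<open>y = z\<^sub>3 - i z\<^sub>4\<close> the quadric is \<open>a x + b y = 1\<close>, and the map is \<open>(a, b, G)\<close> with
  \<open>G = b x y\<^sup>2 + i a x\<^sup>2 y\<close>. Since \<open>a\<close> and \<open>b\<close> can be read off from the image, everything happens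
  on the fibre over a fixed \<open>(a, b)\<close>, which is an affine line with direction \<open>(b, -a)\<close>. On that
  line \<open>G\<close> is a cubic polynomial in one complex parameter. The map is an embedding of a compact
  hypersurface as soon as \<open>G\<close> separates its points on each such line and has nonzero slope there.

  Two facts give this near \<open>s = 1\<close>. First, on the hypersurface with parameter \<open>s\<close>,
  \<open>\<bar>x - cnj a\<bar>\<^sup>2 + \<bar>y - cnj b\<bar>\<^sup>2 = 2 (s - 1)\<close>, because the mixed terms on the left add up to
  \<open>- 2 Re (a x + b y) = - 2\<close>. So the points of the hypersurface are close to real points, for
  which \<open>u = a x\<close> equals \<open>\<bar>a\<bar>\<^sup>2\<close> and is real, and two of them on the same line are close to
  each other (lemma \<open>near_real_deviation\<close>). Secondly, the slope of \<open>G\<close> along the line is a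
  quadratic polynomial in \<open>u\<close> alone, both of whose roots have imaginary part \<open>1/6\<close>
  (lemma \<open>fibre_slope_factor\<close>). Hence the slope stays away from \<open>0\<close> when \<open>u\<close> is nearly real. This is
  the Ahern-Rudin embedding property of the real sphere in quantitative form.

  A nonzero slope makes the map an immersion, in fact on all complex tangent directions of the
  quadric. For injectivity, two points at parameter distance \<open>m\<close> on a line have values of \<open>G\<close>
  that differ by \<open>m\<close> times the slope plus terms of order \<open>m\<^sup>2\<close> and \<open>m\<^sup>3\<close>, and the
  slope dominates since \<open>\<bar>m\<bar>\<close> is of order \<open>10\<^sup>-\<^sup>3\<close> (lemma \<open>fibre_cubic_inj\<close>).
\<close>

section \<open>Polynomial maps are smooth\<close>

text \<open>
  Polynomials are closed under directional derivatives. This is what allows an induction on the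
  order of differentiation.
\<close>

lemma real_polynomial_function_has_derivative:
  fixes p :: "'a::real_normed_vector \<Rightarrow> real"
  assumes "real_polynomial_function p"
  shows "\<exists>p'. (\<forall>x. (p has_derivative p' x) (at x)) \<and>
               (\<forall>v. real_polynomial_function (\<lambda>x. p' x v))"
  using assms
proof (induction p)
  case (linear f)
  then show ?case
    by (intro exI[of _ "\<lambda>x. f"]) (auto intro: bounded_linear_imp_has_derivative)
next
  case (const c)
  then show ?case
    by (intro exI[of _ "\<lambda>x v. 0"]) auto
next
  case (add f g)
  then obtain f' g' where
      "\<And>x. (f has_derivative f' x) (at x)" "\<And>x. (g has_derivative g' x) (at x)"
      "\<And>v. real_polynomial_function (\<lambda>x. f' x v)" "\<And>v. real_polynomial_function (\<lambda>x. g' x v)"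
    by blast
  then show ?case
    by (intro exI[of _ "\<lambda>x v. f' x v + g' x v"])
       (auto intro: has_derivative_add)
next
  case (mult f g)
  then obtain f' g' where
      "\<And>x. (f has_derivative f' x) (at x)" "\<And>x. (g has_derivative g' x) (at x)"
      "\<And>v. real_polynomial_function (\<lambda>x. f' x v)" "\<And>v. real_polynomial_function (\<lambda>x. g' x v)"
    by blast
  then show ?case using mult.hyps
    by (intro exI[of _ "\<lambda>x v. f x * g' x v + f' x v * g x"])
       (auto intro!: has_derivative_mult real_polynomial_function.intros(3,4))
qed

lemma polynomial_function_has_derivative:
  fixes f :: "'a::euclidean_space \<Rightarrow> 'b::euclidean_space"
  assumes "polynomial_function f"
  shows "(f has_derivative frechet_derivative f (at x)) (at x)"
    and "polynomial_function (\<lambda>x. frechet_derivative f (at x) v)"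
proof -
  have "\<forall>i\<in>Basis. \<exists>p'. (\<forall>x. ((\<lambda>x. f x \<bullet> i) has_derivative p' x) (at x)) \<and>
                       (\<forall>v. real_polynomial_function (\<lambda>x. p' x v))"
    using assms polynomial_function_iff_Basis_inner real_polynomial_function_has_derivative by blast
  then obtain d where d: "\<And>i x. i \<in> Basis \<Longrightarrow> ((\<lambda>x. f x \<bullet> i) has_derivative d i x) (at x)"
      "\<And>i v. i \<in> Basis \<Longrightarrow> real_polynomial_function (\<lambda>x. d i x v)"
    by metis
  define f' where "f' = (\<lambda>x v. \<Sum>i\<in>Basis. d i x v *\<^sub>R i)"
  have comp: "f' x v \<bullet> i = d i x v" if "i \<in> Basis" for x v i
    using that by (simp add: f'_def)
  have deriv: "(f has_derivative f' x) (at x)" for x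
    by (subst has_derivative_componentwise_within) (simp add: comp d)
  then have eq: "frechet_derivative f (at x) = f' x" for x
    by (simp add: frechet_derivative_at[symmetric])
  show "(f has_derivative frechet_derivative f (at x)) (at x)"
    using deriv by (simp add: eq)
  show "polynomial_function (\<lambda>x. frechet_derivative f (at x) v)"
    by (simp add: eq polynomial_function_iff_Basis_inner comp d)
qed

lemma polynomial_function_imp_Cinf:
  fixes f :: "'a::euclidean_space \<Rightarrow> 'b::euclidean_space"
  assumes "polynomial_function f"
  shows "Cinf_on_open UNIV f"
proof -
  have "Ck_on_open k UNIV f" for k
    using assms
  proof (induction k arbitrary: f)
    case 0
    then show ?case
      by (simp add: continuous_on_polymonial_function)
  next
    case (Suc k)
    then show ?case
      using polynomial_function_has_derivative(2)[OF Suc.prems]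
      by (simp add: differentiable_on_polynomial_function)
  qed
  then show ?thesis
    by (simp add: Cinf_on_open_def)
qed

section \<open>The extended Ahern-Rudin map is polynomial\<close>

lemma polynomial_function_complex_iff:
  fixes f :: "'a::real_normed_vector \<Rightarrow> complex"
  shows "polynomial_function f \<longleftrightarrow>
    real_polynomial_function (\<lambda>x. Re (f x)) \<and> real_polynomial_function (\<lambda>x. Im (f x))"
  by (auto simp: polynomial_function_iff_Basis_inner Basis_complex_def)

lemma polynomial_function_complex_mult:
  fixes f g :: "'a::real_normed_vector \<Rightarrow> complex"
  assumes "polynomial_function f" "polynomial_function g"
  shows "polynomial_function (\<lambda>x. f x * g x)"
  using assms
  by (auto simp: polynomial_function_complex_iff intro!: real_polynomial_function_diff)

lemma polynomial_function_vec_nth: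
  "polynomial_function (\<lambda>z::complex^'n. z $ i)"
  by (simp add: bounded_linear_vec_nth polynomial_function_bounded_linear)

lemma polynomial_function_F: "polynomial_function F"
proof -
  have nth: "polynomial_function (\<lambda>z. F z $ i)" for i
  proof -
    consider "i = 1" | "i = 2" | "i = 3" using exhaust_3 by blast
    then show ?thesis
      by cases (simp_all only: F_def vector_3 power2_eq_square,
          (intro polynomial_function_add
          polynomial_function_diff polynomial_function_complex_mult polynomial_function_const
          polynomial_function_vec_nth)+)
  qed
  show ?thesis
    unfolding polynomial_function_iff_Basis_inner
  proof
    fix e :: "complex^3" assume "e \<in> Basis"
    then obtain u i where "u \<in> Basis" "e = axis i u"
      by (auto simp: Basis_vec_def)
    then show "real_polynomial_function (\<lambda>z. F z \<bullet> e)"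
      using nth[of i] by (auto simp: inner_axis polynomial_function_iff_Basis_inner)
  qed
qed

section \<open>The third component along a fibre\<close>

definition fibre_cubic :: "complex \<Rightarrow> complex \<Rightarrow> complex \<Rightarrow> complex \<Rightarrow> complex" where
  "fibre_cubic a b x y = b * x * y\<^sup>2 + \<i> * a * x\<^sup>2 * y"

text \<open>
  The derivative of \<open>fibre_cubic a b\<close> in the direction \<open>(b, -a)\<close>, expressed in \<open>u = a x\<close> and
  \<open>v = b y\<close>; up to the factor \<open>a b\<close>, half the second derivative is \<open>fibre_curvature\<close> below.
\<close>

definition fibre_slope :: "complex \<Rightarrow> complex \<Rightarrow> complex" where
  "fibre_slope u v = v\<^sup>2 + 2 * \<i> * u * v - 2 * u * v - \<i> * u\<^sup>2"

definition fibre_curvature :: "complex \<Rightarrow> complex \<Rightarrow> complex" where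
  "fibre_curvature u v = (u - 2 * v) + \<i> * (v - 2 * u)"

text \<open>
  Any two points of the quadric over the same \<open>(a, b)\<close> differ by a multiple \<open>m\<close> of \<open>(b, -a)\<close>. The
  Taylor expansion reduces equality of their values, when \<open>m \<noteq> 0\<close>, to the vanishing of the
  second factor, in which the slope is the dominant term for small \<open>m\<close>.
\<close>

lemma fibre_cubic_shift:
  "fibre_cubic a b (x + m * b) (y - m * a) - fibre_cubic a b x y =
     m * (fibre_slope (a * x) (b * y) + m * (a * b * fibre_curvature (a * x) (b * y))
          + m\<^sup>2 * ((1 - \<i>) * (a * b)\<^sup>2))"
  unfolding fibre_cubic_def fibre_slope_def fibre_curvature_def by algebra

text \<open>
  On the quadric \<open>v = 1 - u\<close>, so the slope is \<open>1 - (4 - 2 i) u + 3 (1 - i) u\<^sup>2\<close>. Its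
  discriminant \<open>-4 i\<close> is the square of \<open>sqrt 2 (1 - i)\<close>, a real multiple of the leading
  coefficient. Therefore the two roots differ by a real number and have the same imaginary part.
\<close>

lemma fibre_slope_factor:
  assumes "u + v = 1"
  shows "fibre_slope u v =
    3 * (1 - \<i>) * (u - Complex (1/2 + sqrt 2 / 6) (1/6)) * (u - Complex (1/2 - sqrt 2 / 6) (1/6))"
proof -
  have v: "v = 1 - u" using assms by (simp add: algebra_simps)
  show ?thesis unfolding fibre_slope_def v
    by (simp add: complex_eq_iff power2_eq_square field_simps)
qed

lemma fibre_slope_lower_bound:
  assumes "u + v = 1" "\<bar>Im u\<bar> \<le> 3 / 1000"
  shows "cmod (fibre_slope u v) \<ge> 1 / 10"
proof -
  \<comment> \<open>\<open>1/6 - 3/1000\<close> exceeds \<open>16/100\<close>.\<close>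
  have far: "cmod (u - Complex r (1/6)) \<ge> 16 / 100" for r
    using abs_Im_le_cmod[of "u - Complex r (1/6)"] assms(2) by simp
  have "cmod (1 - \<i>) \<ge> 14 / 10"
    unfolding cmod_def by (intro real_le_rsqrt) (simp add: power2_eq_square)
  then have "3 * (14 / 10) * (16 / 100) * (16 / 100) \<le> cmod (fibre_slope u v)"
    unfolding fibre_slope_factor[OF assms(1)] norm_mult
    by (intro mult_mono far) auto
  then show ?thesis by simp
qed

section \<open>Points of the quadric close to real points\<close>

text \<open>
  The isotropic coordinates double the squared norm, so the bound is twice \<open>1 + 1 / 10\<^sup>6\<close>. The real
  points of the quadric are those with \<open>x = cnj a\<close> and \<open>y = cnj b\<close>, where the sum of squares takes
  its minimum \<open>2\<close>.
\<close>

definition near_real :: "complex \<Rightarrow> complex \<Rightarrow> complex \<Rightarrow> complex \<Rightarrow> bool" where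
  "near_real a b x y \<longleftrightarrow> a * x + b * y = 1 \<and>
     (cmod a)\<^sup>2 + (cmod b)\<^sup>2 + (cmod x)\<^sup>2 + (cmod y)\<^sup>2 \<le> 2 + 2 / 10 ^ 6"

lemma near_real_deviation:
  assumes "near_real a b x y"
  shows "(cmod (x - cnj a))\<^sup>2 + (cmod (y - cnj b))\<^sup>2 \<le> 2 / 10 ^ 6"
proof -
  have "Re (a * x + b * y) = 1" using assms by (simp add: near_real_def)
  moreover have "(cmod (x - cnj a))\<^sup>2 + (cmod (y - cnj b))\<^sup>2 =
      (cmod a)\<^sup>2 + (cmod b)\<^sup>2 + (cmod x)\<^sup>2 + (cmod y)\<^sup>2 - 2 * Re (a * x + b * y)"
    unfolding cmod_power2 by (simp add: power2_eq_square algebra_simps)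
  ultimately show ?thesis using assms by (simp add: near_real_def)
qed

text \<open>
  By Cauchy-Schwarz, \<open>1 = \<bar>a x + b y\<bar>\<^sup>2\<close> is at most the product of \<open>\<bar>a\<bar>\<^sup>2 + \<bar>b\<bar>\<^sup>2\<close> and
  \<open>\<bar>x\<bar>\<^sup>2 + \<bar>y\<bar>\<^sup>2\<close>, and the latter is bounded. So the fibre really is a line with nonzero
  direction vector, and distances on it control the parameter.
\<close>

lemma near_real_base_nonzero:
  assumes "near_real a b x y"
  shows "(cmod a)\<^sup>2 + (cmod b)\<^sup>2 \<ge> 1 / 3"
proof -
  let ?r = "(cmod a)\<^sup>2 + (cmod b)\<^sup>2" and ?s = "(cmod x)\<^sup>2 + (cmod y)\<^sup>2"
  have rs: "?r + ?s \<le> 3" using assms by (simp add: near_real_def)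
  have "1 = cmod (a * x + b * y)" using assms by (simp add: near_real_def)
  also have "\<dots> \<le> cmod a * cmod x + cmod b * cmod y"
    by (metis norm_mult norm_triangle_ineq)
  finally have "1 \<le> (cmod a * cmod x + cmod b * cmod y)\<^sup>2"
    by (simp add: one_le_power)
  also have "\<dots> \<le> ?r * ?s"
    using sum_squares_ge_zero[of "cmod a * cmod y - cmod b * cmod x" 0]
    by (simp add: power2_eq_square algebra_simps)
  also have "\<dots> \<le> ?r * 3"
    using rs by (intro mult_left_mono) (auto intro: order_trans[rotated])
  finally show ?thesis by simp
qed

text \<open>
  Since \<open>a cnj a\<close> is real, the imaginary part of \<open>a x\<close> is that of \<open>a (x - cnj a)\<close>, which is small.
\<close>

lemma near_real_slope:
  assumes "near_real a b x y"
  shows "cmod (fibre_slope (a * x) (b * y)) \<ge> 1 / 10"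
proof (rule fibre_slope_lower_bound)
  show "a * x + b * y = 1" using assms by (simp add: near_real_def)
  have "(cmod a)\<^sup>2 + (cmod b)\<^sup>2 + (cmod x)\<^sup>2 + (cmod y)\<^sup>2 \<le> 4"
    using assms by (simp add: near_real_def)
  then have "(cmod a)\<^sup>2 \<le> 4"
    using zero_le_power2[of "cmod b"] zero_le_power2[of "cmod x"] zero_le_power2[of "cmod y"]
    by linarith
  then have a: "cmod a \<le> 2" using power2_le_imp_le[of "cmod a" 2] by simp
  have "(cmod (x - cnj a))\<^sup>2 \<le> (cmod (x - cnj a))\<^sup>2 + (cmod (y - cnj b))\<^sup>2" by simp
  also have "\<dots> \<le> (15/10000)\<^sup>2"
    using near_real_deviation[OF assms] by (rule order_trans) (simp add: power2_eq_square)
  finally have d: "cmod (x - cnj a) \<le> 15/10000" by (rule power2_le_imp_le) simp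
  have "Im (a * x) = Im (a * (x - cnj a))" by (simp add: algebra_simps)
  also have "\<bar>\<dots>\<bar> \<le> cmod a * cmod (x - cnj a)"
    by (metis abs_Im_le_cmod norm_mult)
  also have "\<dots> \<le> 2 * (15/10000)" using a d by (intro mult_mono) auto
  finally show "\<bar>Im (a * x)\<bar> \<le> 3 / 1000" by simp
qed

lemma orthogonal_line_param:
  fixes a b p q :: complex
  assumes "a * p + b * q = 0" "(cmod a)\<^sup>2 + (cmod b)\<^sup>2 \<noteq> 0"
  obtains m where "p = m * b" "q = - m * a"
proof (cases "a = 0")
  case True
  then have "b \<noteq> 0" using assms(2) by auto
  then show ?thesis using that[of "p / b"] assms(1) True by simp
next
  case False
  have "a * p = - (b * q)" using assms(1) by (simp add: eq_neg_iff_add_eq_0)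
  then have "p = - (b * q) / a" using False by (metis nonzero_mult_div_cancel_left)
  then show ?thesis using that[of "- q / a"] False by (simp add: mult.commute)
qed

text \<open>
  If the values agree at two points at parameter distance \<open>m \<noteq> 0\<close>, then the slope is cancelled by
  the higher terms of the expansion. But both points lie within \<open>sqrt 2 / 10\<^sup>3\<close> of the same point
  \<open>(cnj a, cnj b)\<close>, so \<open>\<bar>m\<bar> \<le> 5 / 10\<^sup>3\<close>, and the higher terms stay below the slope bound.
\<close>

lemma fibre_cubic_inj:
  assumes P: "near_real a b x y" and Q: "near_real a b x' y'"
    and eq: "fibre_cubic a b x y = fibre_cubic a b x' y'"
  shows "x = x' \<and> y = y'"
proof -
  let ?r = "(cmod a)\<^sup>2 + (cmod b)\<^sup>2"
  have r: "?r \<ge> 1 / 3" using near_real_base_nonzero[OF P] .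
  have "a * (x' - x) + b * (y' - y) = 0"
    using P Q by (simp add: near_real_def algebra_simps)
  then obtain m where m: "x' - x = m * b" "y' - y = - m * a"
    using r by (elim orthogonal_line_param) auto
  have x': "x' = x + m * b" and y': "y' = y - m * a" using m by (simp_all add: algebra_simps)
  let ?S = "fibre_slope (a * x) (b * y)" and ?C = "fibre_curvature (a * x) (b * y)"
  have "m = 0"
  proof (rule ccontr)
    assume "m \<noteq> 0"
    then have zero: "?S + m * (a * b * ?C) + m\<^sup>2 * ((1 - \<i>) * (a * b)\<^sup>2) = 0"
      using fibre_cubic_shift[of a b x m y] eq by (simp add: x' y')
    \<comment> \<open>The parallelogram law for \<open>p - c\<close> and \<open>q - c\<close>, without the term for their sum.\<close>
    have par: "(cmod (p - q))\<^sup>2 \<le> 2 * (cmod (p - c))\<^sup>2 + 2 * (cmod (q - c))\<^sup>2" for p q c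
      using zero_le_power2[of "cmod (p + q - 2 * c)"] unfolding cmod_power2
      by (simp add: power2_eq_square algebra_simps)
    have "(cmod m)\<^sup>2 * ?r = (cmod (x' - x))\<^sup>2 + (cmod (y' - y))\<^sup>2"
      by (simp add: m norm_mult power_mult_distrib algebra_simps)
    also have "\<dots> \<le> 8 / 10 ^ 6"
      using par[of x' x "cnj a"] par[of y' y "cnj b"] near_real_deviation[OF P] near_real_deviation[OF Q]
      by linarith
    finally have "(cmod m)\<^sup>2 * ?r \<le> 8 / 10 ^ 6" .
    moreover have "(cmod m)\<^sup>2 * (1/3) \<le> (cmod m)\<^sup>2 * ?r"
      using r by (intro mult_left_mono) auto
    ultimately have "(cmod m)\<^sup>2 \<le> (5/1000)\<^sup>2" by (simp add: power2_eq_square)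
    then have mb: "cmod m \<le> 5/1000" by (rule power2_le_imp_le) simp
    have amgm: "cmod p * cmod q \<le> 101/100" if "(cmod p)\<^sup>2 + (cmod q)\<^sup>2 \<le> 202/100" for p q
      using that zero_le_power2[of "cmod p - cmod q"]
      by (simp add: power2_eq_square algebra_simps)
    have sq: "(cmod a)\<^sup>2 + (cmod b)\<^sup>2 + (cmod x)\<^sup>2 + (cmod y)\<^sup>2 \<le> 202/100"
      using P by (simp add: near_real_def)
    note nn = zero_le_power2[of "cmod a"] zero_le_power2[of "cmod b"]
      zero_le_power2[of "cmod x"] zero_le_power2[of "cmod y"]
    have ab: "cmod (a * b) \<le> 101/100" and ax: "cmod (a * x) \<le> 101/100" and by': "cmod (b * y) \<le> 101/100"
      unfolding norm_mult by (intro amgm; use sq nn in linarith)+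
    have "cmod ?C \<le> cmod (a*x - 2 * (b*y)) + cmod (b*y - 2 * (a*x))"
      unfolding fibre_curvature_def by (rule order_trans[OF norm_triangle_ineq]) (simp add: norm_mult)
    also have "\<dots> \<le> (cmod (a*x) + 2 * cmod (b*y)) + (cmod (b*y) + 2 * cmod (a*x))"
      by (intro add_mono; rule order_trans[OF norm_triangle_ineq4]) (simp_all add: norm_mult)
    also have "\<dots> \<le> 606/100" using ax by' by simp
    finally have C: "cmod ?C \<le> 606/100" .
    have two: "cmod (1 - \<i>) \<le> 2"
      using norm_triangle_ineq4[of 1 \<i>] by simp
    have "?S = - (m * (a * b * ?C) + m\<^sup>2 * ((1 - \<i>) * (a * b)\<^sup>2))"
      using zero by (simp only: add.assoc eq_neg_iff_add_eq_0)
    then have "cmod ?S = cmod (m * (a * b * ?C) + m\<^sup>2 * ((1 - \<i>) * (a * b)\<^sup>2))"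
      by (simp only: norm_minus_cancel)
    also have "\<dots> \<le> cmod m * (cmod (a * b) * cmod ?C) + (cmod m)\<^sup>2 * (cmod (1 - \<i>) * (cmod (a * b))\<^sup>2)"
      by (rule order_trans[OF norm_triangle_ineq]) (simp add: norm_mult norm_power)
    also have "\<dots> \<le> 5/1000 * (101/100 * (606/100)) + (5/1000)\<^sup>2 * (2 * (101/100)\<^sup>2)"
      using mb ab C two by (intro add_mono mult_mono power_mono) auto
    also have "\<dots> < 1 / 10" by (simp add: power2_eq_square)
    finally show False using near_real_slope[OF P] by simp
  qed
  then show ?thesis by (simp add: x' y')
qed

section \<open>Injectivity\<close>

lemma M3_near_real:
  assumes "z \<in> M3 s" "s \<le> 1 + 1 / 10 ^ 6"
  shows "near_real (z$1 + \<i> * z$2) (z$3 + \<i> * z$4) (z$1 - \<i> * z$2) (z$3 - \<i> * z$4)"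
proof -
  have par: "(cmod (p + \<i> * q))\<^sup>2 + (cmod (p - \<i> * q))\<^sup>2 = 2 * ((cmod p)\<^sup>2 + (cmod q)\<^sup>2)" for p q
    unfolding cmod_power2 by (simp add: power2_eq_square algebra_simps)
  have "(z$1 + \<i> * z$2) * (z$1 - \<i> * z$2) + (z$3 + \<i> * z$4) * (z$3 - \<i> * z$4)
      = (z$1)\<^sup>2 + (z$2)\<^sup>2 + (z$3)\<^sup>2 + (z$4)\<^sup>2"
    by (simp add: power2_eq_square algebra_simps)
  moreover have "(z$1)\<^sup>2 + (z$2)\<^sup>2 + (z$3)\<^sup>2 + (z$4)\<^sup>2 = 1"
    using assms(1) by (simp add: M3_def Q3_def)
  ultimately show ?thesis
    using assms par[of "z$1" "z$2"] par[of "z$3" "z$4"] by (simp add: near_real_def M3_def)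
qed

lemma F_nth:
  "F z $ 1 = z$1 + \<i> * z$2" "F z $ 2 = z$3 + \<i> * z$4"
  "F z $ 3 = fibre_cubic (z$1 + \<i> * z$2) (z$3 + \<i> * z$4) (z$1 - \<i> * z$2) (z$3 - \<i> * z$4)"
  by (simp_all add: F_def fibre_cubic_def)

lemma isotropic_coordinates_eq_iff:
  fixes p q p' q' :: complex
  shows "p = p' \<and> q = q' \<longleftrightarrow> p + \<i> * q = p' + \<i> * q' \<and> p - \<i> * q = p' - \<i> * q'"
  by (auto simp: complex_eq_iff)

lemma F_tilde_eq_F: "z \<in> M3 s \<Longrightarrow> F_tilde z = F z"
  by (simp add: F_tilde_def M3_def)

lemma inj_on_F_tilde_M3:
  assumes "s \<le> 1 + 1 / 10 ^ 6"
  shows "inj_on F_tilde (M3 s)"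
proof (rule inj_onI)
  fix z z' assume z: "z \<in> M3 s" "z' \<in> M3 s" and "F_tilde z = F_tilde z'"
  then have F: "F z $ i = F z' $ i" for i by (simp add: F_tilde_eq_F)
  note near = M3_near_real[OF z(1) assms] M3_near_real[OF z(2) assms]
  have a: "z$1 + \<i> * z$2 = z'$1 + \<i> * z'$2" and b: "z$3 + \<i> * z$4 = z'$3 + \<i> * z'$4"
    using F[of 1] F[of 2] by (simp_all add: F_nth)
  have "z$1 - \<i> * z$2 = z'$1 - \<i> * z'$2 \<and> z$3 - \<i> * z$4 = z'$3 - \<i> * z'$4"
    using near F[of 3] unfolding F_nth a b by (intro fibre_cubic_inj)
  then have "z$1 = z'$1 \<and> z$2 = z'$2" "z$3 = z'$3 \<and> z$4 = z'$4"
    using a b isotropic_coordinates_eq_iff[of "z$1" "z'$1" "z$2" "z'$2"]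
      isotropic_coordinates_eq_iff[of "z$3" "z'$3" "z$4" "z'$4"] by simp_all
  then show "z = z'" by (simp add: vec_eq_iff forall_4)
qed

section \<open>Immersion\<close>

text \<open>
  Differentiating the equation of the quadric along a curve on the hypersurface. Together with a
  vanishing derivative of the first two components of the map, this equation confines a tangent
  vector to the direction of the fibre.
\<close>

lemma tangent_vectors_Q3:
  assumes "v \<in> tangent_vectors (M3 s) p"
  shows "p$1 * v$1 + p$2 * v$2 + p$3 * v$3 + p$4 * v$4 = 0"
proof -
  obtain \<gamma> \<epsilon> where \<epsilon>: "\<epsilon> > 0" and sub: "\<gamma> ` {-\<epsilon><..<\<epsilon>} \<subseteq> M3 s" and p: "\<gamma> 0 = p"
    and \<gamma>: "(\<gamma> has_vector_derivative v) (at 0)"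
    using assms by (auto simp: tangent_vectors_def)
  define q where "q \<tau> = (\<gamma> \<tau> $ 1)\<^sup>2 + (\<gamma> \<tau> $ 2)\<^sup>2 + (\<gamma> \<tau> $ 3)\<^sup>2 + (\<gamma> \<tau> $ 4)\<^sup>2" for \<tau>
  have n: "((\<lambda>\<tau>. \<gamma> \<tau> $ i) has_vector_derivative v $ i) (at 0)" for i
    using bounded_linear.has_vector_derivative[OF bounded_linear_vec_nth \<gamma>] .
  have "(q has_vector_derivative 2 * (p$1 * v$1 + p$2 * v$2 + p$3 * v$3 + p$4 * v$4)) (at 0)"
    unfolding q_def power2_eq_square
    by (rule has_vector_derivative_eq_rhs, (rule has_vector_derivative_add has_vector_derivative_mult n)+)
       (simp add: p algebra_simps)
  moreover have "(q has_vector_derivative 0) (at 0)"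
  proof (rule has_vector_derivative_transform_within_open)
    show "((\<lambda>_. 1) has_vector_derivative 0) (at (0::real))" by simp
    show "open {-\<epsilon><..<\<epsilon>}" "0 \<in> {-\<epsilon><..<\<epsilon>}" using \<epsilon> by auto
    show "1 = q \<tau>" if "\<tau> \<in> {-\<epsilon><..<\<epsilon>}" for \<tau>
      using sub that by (force simp: q_def M3_def Q3_def)
  qed
  ultimately have "2 * (p$1 * v$1 + p$2 * v$2 + p$3 * v$3 + p$4 * v$4) = 0"
    by (rule vector_derivative_unique_at)
  then show ?thesis by (simp only: mult_eq_0_iff) simp
qed

lemma frechet_derivative_F_nth:
  fixes p v :: "complex^4"
  defines "a \<equiv> p$1 + \<i> * p$2" and "b \<equiv> p$3 + \<i> * p$4" and "x \<equiv> p$1 - \<i> * p$2" and "y \<equiv> p$3 - \<i> * p$4"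
  defines "da \<equiv> v$1 + \<i> * v$2" and "db \<equiv> v$3 + \<i> * v$4" and "dx \<equiv> v$1 - \<i> * v$2" and "dy \<equiv> v$3 - \<i> * v$4"
  shows "frechet_derivative F (at p) v $ 1 = da"
    and "frechet_derivative F (at p) v $ 2 = db"
    and "frechet_derivative F (at p) v $ 3 =
      db * (x * y\<^sup>2) + da * (\<i> * x\<^sup>2 * y) + dx * (b * y\<^sup>2 + 2 * \<i> * a * x * y)
        + dy * (2 * b * x * y + \<i> * a * x\<^sup>2)"
proof -
  have D: "((\<lambda>z. F z $ i) has_derivative (\<lambda>h. frechet_derivative F (at p) h $ i)) (at p)" for i
    using bounded_linear.has_derivative[OF bounded_linear_vec_nth
        polynomial_function_has_derivative(1)[OF polynomial_function_F]] .
  have n: "((\<lambda>z::complex^4. z $ i) has_derivative (\<lambda>h. h $ i)) (at p)" for i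
    by (simp add: bounded_linear_imp_has_derivative bounded_linear_vec_nth)
  note [derivative_intros] = n
  have "((\<lambda>z. F z $ 1) has_derivative (\<lambda>h. h$1 + \<i> * h$2)) (at p)"
    unfolding F_nth by (auto intro!: derivative_eq_intros)
  from has_derivative_unique[OF D this] show "frechet_derivative F (at p) v $ 1 = da"
    by (simp add: da_def fun_eq_iff)
  have "((\<lambda>z. F z $ 2) has_derivative (\<lambda>h. h$3 + \<i> * h$4)) (at p)"
    unfolding F_nth by (auto intro!: derivative_eq_intros)
  from has_derivative_unique[OF D this] show "frechet_derivative F (at p) v $ 2 = db"
    by (simp add: db_def fun_eq_iff)
  have "((\<lambda>z. F z $ 3) has_derivative (\<lambda>h.
      (h$3 + \<i> * h$4) * (x * y\<^sup>2) + (h$1 + \<i> * h$2) * (\<i> * x\<^sup>2 * y)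
        + (h$1 - \<i> * h$2) * (b * y\<^sup>2 + 2 * \<i> * a * x * y)
        + (h$3 - \<i> * h$4) * (2 * b * x * y + \<i> * a * x\<^sup>2))) (at p)"
    unfolding F_nth fibre_cubic_def power2_eq_square
    by (rule has_derivative_eq_rhs,
        (rule has_derivative_add has_derivative_diff has_derivative_mult has_derivative_const n)+)
       (simp add: a_def b_def x_def y_def algebra_simps fun_eq_iff)
  from has_derivative_unique[OF D this] show "frechet_derivative F (at p) v $ 3 =
      db * (x * y\<^sup>2) + da * (\<i> * x\<^sup>2 * y) + dx * (b * y\<^sup>2 + 2 * \<i> * a * x * y)
        + dy * (2 * b * x * y + \<i> * a * x\<^sup>2)"
    by (simp add: da_def db_def dx_def dy_def fun_eq_iff)
qed

text \<open>
  A kernel vector has vanishing first two components of the image, so it points along the fibre;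
  tangency to the quadric makes it a multiple \<open>m\<close> of \<open>(b, -a)\<close>, and the third component of its
  image is \<open>m\<close> times the slope.
\<close>

lemma frechet_derivative_F_kernel:
  assumes p: "p \<in> M3 s" "s \<le> 1 + 1 / 10 ^ 6"
    and tangent: "p$1 * v$1 + p$2 * v$2 + p$3 * v$3 + p$4 * v$4 = 0"
    and kernel: "frechet_derivative F (at p) v = 0"
  shows "v = 0"
proof -
  define a b x y where "a = p$1 + \<i> * p$2" and "b = p$3 + \<i> * p$4"
    and "x = p$1 - \<i> * p$2" and "y = p$3 - \<i> * p$4"
  define dx dy where "dx = v$1 - \<i> * v$2" and "dy = v$3 - \<i> * v$4"
  note defs = a_def b_def x_def y_def dx_def dy_def
  have near: "near_real a b x y" using M3_near_real[OF p] by (simp add: defs)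
  have da: "v$1 + \<i> * v$2 = 0" and db: "v$3 + \<i> * v$4 = 0"
    using frechet_derivative_F_nth(1,2)[of p v] kernel by simp_all
  have cubic: "dx * (b * y\<^sup>2 + 2 * \<i> * a * x * y) + dy * (2 * b * x * y + \<i> * a * x\<^sup>2) = 0"
    using frechet_derivative_F_nth(3)[of p v] kernel da db by (simp add: defs)
  have "a * dx + b * dy + (x * (v$1 + \<i> * v$2) + y * (v$3 + \<i> * v$4)) =
      2 * (p$1 * v$1 + p$2 * v$2 + p$3 * v$3 + p$4 * v$4)"
    by (simp add: defs algebra_simps)
  then have "a * dx + b * dy = 0" using tangent da db by simp
  then obtain m where m: "dx = m * b" "dy = - m * a"
    using near_real_base_nonzero[OF near] by (elim orthogonal_line_param) auto
  have "m * fibre_slope (a * x) (b * y) = 0"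
    using cubic unfolding m fibre_slope_def by algebra
  then have "m = 0" using near_real_slope[OF near] by auto
  then have "v$1 = 0 \<and> v$2 = 0" "v$3 = 0 \<and> v$4 = 0"
    using da db m isotropic_coordinates_eq_iff[of "v$1" 0 "v$2" 0] isotropic_coordinates_eq_iff[of "v$3" 0 "v$4" 0]
    by (simp_all add: dx_def dy_def)
  then show ?thesis by (simp add: vec_eq_iff forall_4)
qed

lemma smooth_on_set_F_tilde: "smooth_on_set (M3 s) F_tilde"
  unfolding smooth_on_set_def
  using polynomial_function_imp_Cinf[OF polynomial_function_F] F_tilde_eq_F
  by (metis UNIV_I Int_iff)

lemma immersion_on_F_tilde:
  assumes "s \<le> 1 + 1 / 10 ^ 6"
  shows "immersion_on (M3 s) F_tilde"
  unfolding immersion_on_def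
proof (intro conjI ballI exI)
  show "smooth_on_set (M3 s) F_tilde" by (rule smooth_on_set_F_tilde)
  fix p assume p: "p \<in> M3 s"
  let ?D = "frechet_derivative F (at p)"
  have D: "(F has_derivative ?D) (at p)"
    using polynomial_function_has_derivative(1)[OF polynomial_function_F] .
  then show "(F_tilde has_derivative ?D) (at p within M3 s)"
    by (rule has_derivative_transform[rotated 2, OF has_derivative_at_withinI]) (use p F_tilde_eq_F in auto)
  show "inj_on ?D (tangent_vectors (M3 s) p)"
  proof (rule inj_onI)
    fix v w assume v: "v \<in> tangent_vectors (M3 s) p" and w: "w \<in> tangent_vectors (M3 s) p"
      and eq: "?D v = ?D w"
    have "?D (v - w) = 0"
      using eq linear_diff[OF has_derivative_linear[OF D]] by simp
    moreover have "p$1 * (v - w)$1 + p$2 * (v - w)$2 + p$3 * (v - w)$3 + p$4 * (v - w)$4 = 0"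
      using tangent_vectors_Q3[OF v] tangent_vectors_Q3[OF w]
      unfolding vector_minus_component by algebra
    ultimately show "v = w"
      using frechet_derivative_F_kernel[OF p assms] by fastforce
  qed
qed

section \<open>Embedding\<close>

lemma compact_M3: "compact (M3 s)"
proof -
  have "norm z = sqrt s" if "z \<in> M3 s" for z
    using that by (simp add: M3_def norm_vec_def L2_set_def sum_4)
  then have "bounded (M3 s)" by (metis boundedI order_refl)
  moreover have "closed (M3 s)"
    unfolding M3_def Q3_def
    by (intro closed_Int closed_Collect_eq continuous_intros)
  ultimately show ?thesis by (simp add: compact_eq_bounded_closed)
qed

lemma smooth_embedding_on_F_tilde:
  assumes "s \<le> 1 + 1 / 10 ^ 6"
  shows "smooth_embedding_on (M3 s) F_tilde"
proof -
  have "continuous_on (M3 s) F_tilde"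
    using continuous_on_polymonial_function[OF polynomial_function_F] F_tilde_eq_F
    by (simp cong: continuous_on_cong)
  then have "\<exists>g. homeomorphism (M3 s) (F_tilde ` M3 s) F_tilde g"
    using homeomorphism_compact[OF compact_M3 _ refl inj_on_F_tilde_M3[OF assms]] by blast
  then show ?thesis
    using immersion_on_F_tilde[OF assms] by (simp add: smooth_embedding_on_def)
qed

theorem theorem3p2:
  shows "t0 \<ge> ereal (1 + 1 / 10 ^ 6)"
  unfolding t0_def by (intro Sup_upper imageI) (simp add: smooth_embedding_on_F_tilde)

end
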